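(* Let $k\ge1$, $g\ge 1$, $n\ge 1$ be integers, let $t$ be an integer with $k\le t\le n$, let $p\in(0,1)$ and $q=1-p$. Let $L$ be the length of the longest success run (of order $k$ with gap $g$) in $n$ independent Bernoulli trials with success probability $p$, with $L=0$ if there is no success run. Then $$P(L\le t)=P_0+\sum_{r=1}^{\lfloor (n+g)/(k+g)\rfloor}\left[B(r,t,n)+C(r,t,n)+q\sum_{w=1}^{g-1}C(r,t,n-w)\right],$$ where $$P_0=\sum_{u=0}^{n}p^{n-u}q^u\sum_{s=0}^{\min(u+1,\lfloor (n-u)/k\rfloor)}(-1)^s\binom{u+1}{s}\binom{n-sk}{u}$$ and, for integers $r\ge1$ and $N$, $$B(r,t,N)=\sum_{u=r}^{\nu'_N-kr}q^u p^{\nu'_N-u}\binom{u}{r}\sum_{v=0}^{\nu'_N-kr-u}A(r,t-k+1,v)\,A(u-r+1,k,\nu'_N-kr-u-v),$$ $$ \begin{aligned} C(r,t,N)&=A\bigl(r,t-k+1,N-kr-(r-1)g\bigr)\,q^{r-1}p^{N-(r-1)g}\\ &\quad+\sum_{u=r}^{\nu_N-kr}q^u p^{\nu_N-u}\binom{u}{r-1}\sum_{v=0}^{\nu_N-kr-u}A(r,t-k+1,v)\,A(u-r+1,k,\nu_N-kr-u-v), \end{aligned} $$ with $\nu_N=N-(r-1)(g-1)$, $\nu'_N=N-r(g-1)$, and $$A(r,i,v)=\sum_{s=0}^{\min(r,\lfloor v/i\rfloor)}(-1)^s\binom{r}{s}\binom{v-is+r-1}{r-1}.$$ Here any sum whose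 upper limit is smaller than its lower limit is zero (in particular $A(r,i,v)=0$ for $v<0$).
   Context: Consider a sequence of $n$ independent trials, each $S$ (success) with probability $p$ or $F$ (failure) with probability $q=1-p$. The success runs (of order $k$ with gap $g$) are defined inductively. The first success run (if it exists) is the first run of at least $k$ consecutive successes, taken maximal (it cannot be extended to a longer run). A success run terminates at trial $m$ if trial $m$ is its last success, i.e. either $m=n$ or trial $m+1$ is a failure. If the $j$-th success run terminates at trial $m$, then the $(j+1)$-th success run (if it exists) is the first run of at least $k$ consecutive successes which begins later than trial $m+g$, taken maximal among runs beginning later than trial $m+g$ (trials $m+1,\dots,m+g$ form the gap: an $F$ followed by $g-1$ arbitrary outcomes). The quantity $P_0$ is the probability that there are no success runs. *)

theory Defs
  imports "HOL-Probability.Probability"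
begin

text \<open>
  The outcome of trials \<open>1, \<dots>, n\<close> is given by \<open>x :: nat \<Rightarrow> bool\<close>, with \<open>True\<close> for success; the
  values of \<open>x\<close> outside \<open>{1..n}\<close> are never used. A run is described by its first trial \<open>a\<close> and its
  last trial \<open>b\<close>; its length is \<open>b + 1 - a\<close>. The parameter \<open>c\<close> restricts attention to runs that
  begin later than trial \<open>c\<close>.
\<close>

definition success_block :: "(nat \<Rightarrow> bool) \<Rightarrow> nat \<Rightarrow> nat \<Rightarrow> nat \<Rightarrow> nat \<Rightarrow> nat \<Rightarrow> bool" where
  "success_block x n k c a b \<longleftrightarrow>
     c < a \<and> a \<le> b \<and> b \<le> n \<and> k \<le> b + 1 - a \<and> (\<forall>i\<in>{a..b}. x i)"

definition maximal_block :: "(nat \<Rightarrow> bool) \<Rightarrow> nat \<Rightarrow> nat \<Rightarrow> nat \<Rightarrow> nat \<Rightarrow> nat \<Rightarrow> bool" where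
  "maximal_block x n k c a b \<longleftrightarrow>
     success_block x n k c a b \<and>
     (\<forall>a' b'. success_block x n k c a' b' \<and> a' \<le> a \<and> b \<le> b' \<longrightarrow> a' = a \<and> b' = b)"

definition first_block :: "(nat \<Rightarrow> bool) \<Rightarrow> nat \<Rightarrow> nat \<Rightarrow> nat \<Rightarrow> nat \<Rightarrow> nat \<Rightarrow> bool" where
  "first_block x n k c a b \<longleftrightarrow>
     maximal_block x n k c a b \<and> (\<forall>a' b'. maximal_block x n k c a' b' \<longrightarrow> a \<le> a')"

text \<open>
  \<open>success_run x n k g j a b\<close>: the \<open>j\<close>-th success run (of order \<open>k\<close> with gap \<open>g\<close>) exists and
  occupies the trials \<open>a, \<dots>, b\<close>. A run following one that terminates at trial \<open>b\<close> is maximal only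
  among the runs beginning later than \<open>b + g\<close>, so it may be preceded by a success inside the gap.
\<close>

inductive success_run :: "(nat \<Rightarrow> bool) \<Rightarrow> nat \<Rightarrow> nat \<Rightarrow> nat \<Rightarrow> nat \<Rightarrow> nat \<Rightarrow> nat \<Rightarrow> bool"
  for x :: "nat \<Rightarrow> bool" and n k g :: nat where
  first_run: "first_block x n k 0 a b \<Longrightarrow> success_run x n k g 1 a b"
| next_run: "success_run x n k g j a b \<Longrightarrow> first_block x n k (b + g) a' b' \<Longrightarrow>
             success_run x n k g (Suc j) a' b'"

definition longest_run :: "(nat \<Rightarrow> bool) \<Rightarrow> nat \<Rightarrow> nat \<Rightarrow> nat \<Rightarrow> nat" where
  "longest_run x n k g =
     Max (insert 0 {l. \<exists>j a b. success_run x n k g j a b \<and> l = b + 1 - a})"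

text \<open>
  All indices of the counting formulas are integers, so that subtraction is not truncated and sums
  over \<open>{a..b}\<close> with \<open>b < a\<close> vanish; \<open>div\<close> is the floor of the quotient. Within the ranges of
  summation below both arguments of every binomial coefficient are nonnegative.
\<close>

definition ibinom :: "int \<Rightarrow> int \<Rightarrow> real" where
  "ibinom m j = real (nat m choose nat j)"

definition A :: "int \<Rightarrow> int \<Rightarrow> int \<Rightarrow> real" where
  "A r i v = (\<Sum>s = 0..min r (v div i).
     (-1) powi s * ibinom r s * ibinom (v - i * s + r - 1) (r - 1))"

definition B :: "int \<Rightarrow> int \<Rightarrow> real \<Rightarrow> real \<Rightarrow> int \<Rightarrow> int \<Rightarrow> int \<Rightarrow> real" where
  "B k g p q r t N = (let \<nu>' = N - r * (g - 1) in
     \<Sum>u = r..\<nu>' - k * r. q powi u * p powi (\<nu>' - u) * ibinom u r *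
       (\<Sum>v = 0..\<nu>' - k * r - u. A r (t - k + 1) v * A (u - r + 1) k (\<nu>' - k * r - u - v)))"

definition C :: "int \<Rightarrow> int \<Rightarrow> real \<Rightarrow> real \<Rightarrow> int \<Rightarrow> int \<Rightarrow> int \<Rightarrow> real" where
  "C k g p q r t N = (let \<nu> = N - (r - 1) * (g - 1) in
     A r (t - k + 1) (N - k * r - (r - 1) * g) * q powi (r - 1) * p powi (N - (r - 1) * g) +
     (\<Sum>u = r..\<nu> - k * r. q powi u * p powi (\<nu> - u) * ibinom u (r - 1) *
       (\<Sum>v = 0..\<nu> - k * r - u. A r (t - k + 1) v * A (u - r + 1) k (\<nu> - k * r - u - v))))"

definition P0 :: "int \<Rightarrow> real \<Rightarrow> real \<Rightarrow> int \<Rightarrow> real" where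
  "P0 k p q n = (\<Sum>u = 0..n. p powi (n - u) * q powi u *
     (\<Sum>s = 0..min (u + 1) ((n - u) div k).
        (-1) powi s * ibinom (u + 1) s * ibinom (n - s * k) u))"

end

theory Submission
  imports Defs
begin

text \<open>
  Let \<open>T\<close> be the generating function in the number of trials of the probability that all success
  runs have length at most \<open>t\<close>, and let \<open>s\<close> and \<open>r\<close> be the sums of \<open>p ^ l * X ^ l\<close> over \<open>l < k\<close> and over
  \<open>k \<le> l \<le> t\<close>. Conditioning on the number of initial successes gives
  \<open>T = s * (1 + q * X * T) + r * (W + q * X ^ g * T)\<close>, where
  \<open>W = 1 + q * (X + \<dots> + X ^ (g - 1))\<close> accounts for a gap cut off by the end of the trials.
  With \<open>J = 1 / (1 - q * X * s)\<close> and \<open>Z = q * X ^ g * r * J\<close> this reads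
  \<open>T = s * J + r * J * W + Z * T\<close>, and iterating it yields \<open>s * J\<close> plus the sum of
  \<open>Z ^ i * s * J + Z ^ (i - 1) * r * J * W\<close> over \<open>i \<ge> 1\<close>. The coefficients of \<open>s * J\<close>,
  \<open>Z ^ i * s * J\<close> and \<open>Z ^ (i - 1) * r * J\<close> are \<open>P0\<close>, \<open>B\<close> and \<open>C\<close>. For \<open>t = k - 1\<close> we have \<open>r = 0\<close>, and
  \<open>T\<close> is the generating function of the probability of no success run.
\<close>

unbundle no vec_syntax
unbundle fps_syntax

subsection \<open>Generating functions of blocks\<close>

definition geo :: "real \<Rightarrow> real fps" where
  "geo c = Abs_fps (\<lambda>n. c ^ n)"

lemma geo_nth [simp]: "geo c $ n = c ^ n"
  by (simp add: geo_def)

lemma geo_inverse: "(1 - fps_const c * fps_X) * geo c = 1"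
proof (rule fps_ext)
  fix n show "((1 - fps_const c * fps_X) * geo c) $ n = 1 $ n"
    by (cases n) (auto simp: algebra_simps mult.assoc)
qed

text \<open>Another factor \<open>geo c\<close> turns coefficients into partial sums, so the
  induction step is the hockey-stick identity for binomials.\<close>

lemma geo_power_nth: "(geo c ^ Suc r) $ n = real (n + r choose r) * c ^ n"
proof (induction r arbitrary: n)
  case 0
  then show ?case by simp
next
  case (Suc r)
  have "(geo c ^ Suc (Suc r)) $ n = (\<Sum>i=0..n. (geo c ^ Suc r) $ i * c ^ (n - i))"
    unfolding power_Suc2[of _ "Suc r"] by (simp add: fps_mult_nth del: power_Suc)
  also have "\<dots> = (\<Sum>i=0..n. real (i + r choose r)) * c ^ n"
    unfolding Suc.IH sum_distrib_right
    by (intro sum.cong refl) (simp flip: power_add)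
  also have "(\<Sum>i=0..n. real (i + r choose r)) = real (\<Sum>i\<le>n. i + r choose r)"
    by (simp add: atLeast0AtMost)
  also have "(\<Sum>i\<le>n. i + r choose r) = (n + Suc r choose Suc r)"
  proof (induction n)
    case (Suc n)
    then show ?case by simp
  qed simp
  finally show ?case .
qed

text \<open>The range is half-open so that \<open>segment p 0 k\<close> and
  \<open>segment p k (Suc t)\<close> are the series s and r, and the latter is zero for t = k -
  1.\<close>

definition segment :: "real \<Rightarrow> nat \<Rightarrow> nat \<Rightarrow> real fps" where
  "segment c a b = Abs_fps (\<lambda>l. if a \<le> l \<and> l < b then c ^ l else 0)"

lemma segment_nth: "segment c a b $ l = (if a \<le> l \<and> l < b then c ^ l else 0)"
  by (simp add: segment_def)

lemma segment_shift: "segment c a (a + i) = fps_const (c ^ a) * fps_X ^ a * segment c 0 i"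
  by (rule fps_ext) (auto simp: segment_nth mult.assoc fps_X_power_mult_nth simp flip: power_add)

lemma segment_eq_geo: "segment c 0 i = geo c * (1 - fps_const (c ^ i) * fps_X ^ i)"
proof (rule fps_ext)
  fix n
  have "geo c * (1 - fps_const (c ^ i) * fps_X ^ i) = geo c - fps_const (c ^ i) * (fps_X ^ i * geo c)"
    by (simp add: algebra_simps)
  then show "segment c 0 i $ n = (geo c * (1 - fps_const (c ^ i) * fps_X ^ i)) $ n"
    by (auto simp: segment_nth fps_X_power_mult_nth simp flip: power_add)
qed

text \<open>The floor bound on s becomes \<open>i * s \<le> v\<close>, the form in which the
  coefficient extraction produces it.\<close>

lemma A_nat:
  assumes "r \<ge> 1" "i \<ge> 1"
  shows "A (int r) (int i) (int v) =
    (\<Sum>s | s \<le> r \<and> i * s \<le> v. (-1) ^ s * real (r choose s) * real (v - i * s + (r - 1) choose (r - 1)))"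
  unfolding A_def
proof (rule sum.reindex_bij_witness[of _ int nat])
  fix s :: int
  assume s: "s \<in> {0..min (int r) (int v div int i)}"
  then have le: "i * nat s \<le> v"
    using assms by (metis atLeastAtMost_iff div_le_mono2 int_nat_eq le_nat_iff min.bounded_iff
        mult.commute nat_int of_nat_le_iff of_nat_mult times_div_less_eq_dividend zdiv_int
        order_trans mult_le_mono2)
  then show "nat s \<in> {s. s \<le> r \<and> i * s \<le> v}" "int (nat s) = s"
    using s by auto
  have "int v - int i * s + int r - 1 = int (v - i * nat s + (r - 1))"
    using le s assms by (simp add: of_nat_diff)
  then show "(-1) ^ nat s * real (r choose nat s) * real (v - i * nat s + (r - 1) choose (r - 1)) =
    (-1) powi s * ibinom (int r) s * ibinom (int v - int i * s + int r - 1) (int r - 1)"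
    using s assms by (simp only: ibinom_def power_int_def nat_int) (simp add: nat_diff_distrib)
next
  fix s assume s: "s \<in> {s. s \<le> r \<and> i * s \<le> v}"
  then show "int s \<in> {0..min (int r) (int v div int i)}"
    using assms by (auto simp: less_eq_div_iff_mult_less_eq mult.commute simp flip: zdiv_int of_nat_mult)
qed auto

text \<open>The r-th power is \<open>geo c ^ r\<close> times (1 - (cX)^i)^r, and the second factor
  is expanded binomially. Thus A(r,i,v) counts the ways to write v as an ordered sum of r parts,
  each from 0 to i - 1.\<close>

lemma segment_power_nth:
  assumes "r \<ge> 1" "i \<ge> 1"
  shows "(segment c 0 i ^ r) $ v = A (int r) (int i) (int v) * c ^ v"
proof -
  obtain m where m: "r = Suc m" using assms by (cases r) auto
  have "segment c 0 i ^ r = geo c ^ r * (fps_const (- (c ^ i)) * fps_X ^ i + 1) ^ r"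
    by (simp add: segment_eq_geo power_mult_distrib flip: fps_const_neg)
  also have "(fps_const (- (c ^ i)) * fps_X ^ i + 1) ^ r
    = (\<Sum>s\<le>r. fps_const ((-1) ^ s * real (r choose s) * c ^ (i * s)) * fps_X ^ (i * s))"
    unfolding binomial_ring
    by (intro sum.cong refl)
      (simp add: power_mult_distrib power_minus[of "c ^ _"] mult_ac fps_const_power
         flip: fps_of_nat power_mult)
  also have "geo c ^ r * \<dots> =
    (\<Sum>s\<le>r. fps_const ((-1) ^ s * real (r choose s) * c ^ (i * s)) * (fps_X ^ (i * s) * geo c ^ r))"
    by (simp add: sum_distrib_left mult_ac)
  finally have "(segment c 0 i ^ r) $ v =
    (\<Sum>s\<le>r. (-1) ^ s * real (r choose s) * c ^ (i * s) *
       (if v < i * s then 0 else real (v - i * s + m choose m) * c ^ (v - i * s)))"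
    unfolding m by (simp only: fps_sum_nth fps_mult_left_const_nth fps_X_power_mult_nth geo_power_nth)
  \<comment> \<open>Terms with i * s > v contribute nothing; this is the bound v div i in
    \<open>A\<close>.\<close>
  also have "\<dots> = (\<Sum>s | s \<le> r \<and> i * s \<le> v. (-1) ^ s * real (r choose s) * c ^ (i * s) *
       (real (v - i * s + m choose m) * c ^ (v - i * s)))"
    by (rule sum.mono_neutral_cong_right) auto
  also have "\<dots> = (\<Sum>s | s \<le> r \<and> i * s \<le> v. (-1) ^ s * real (r choose s) *
       real (v - i * s + m choose m) * c ^ v)"
    by (intro sum.cong refl) (simp add: mult_ac flip: power_add)
  finally show ?thesis
    unfolding A_nat[OF assms] by (simp add: m sum_distrib_right)
qed

lemma sum_int_from_0: "(\<Sum>v = 0..int M. f v) = (\<Sum>v\<le>M. f (int v))"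
  by (rule sum.reindex_bij_witness[of _ int nat]) auto

lemma sum_int_from_1: "(\<Sum>i = 1..int m. f i) = (\<Sum>i = 1..m. f (int i))"
  by (rule sum.reindex_bij_witness[of _ int nat]) auto

lemma segment_power_mult_nth:
  assumes "r \<ge> 1" "i \<ge> 1" "m \<ge> 1" "k \<ge> 1"
  shows "(segment p 0 i ^ r * segment p 0 k ^ m) $ M =
    p ^ M * (\<Sum>v = 0..int M. A (int r) (int i) v * A (int m) (int k) (int M - v))"
  unfolding sum_int_from_0 fps_mult_nth atLeast0AtMost sum_distrib_left
  using assms
  by (intro sum.cong refl)
     (simp add: segment_power_nth of_nat_diff power_add[symmetric] mult_ac flip: of_nat_diff)

text \<open>\<open>star q s\<close> is \<open>1 / (1 - q * X * s)\<close>.\<close>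

definition star :: "real \<Rightarrow> real fps \<Rightarrow> real fps" where
  "star q s = geo 1 oo (fps_const q * fps_X * s)"

lemma star_inverse: "(1 - fps_const q * fps_X * s) * star q s = 1"
proof -
  let ?y = "fps_const q * fps_X * s"
  have "((1 - fps_X) * geo 1) oo ?y = 1"
    using geo_inverse[of 1] by simp
  then show ?thesis
    by (simp add: star_def fps_compose_mult_distrib fps_compose_sub_distrib)
qed

text \<open>With y = q X s, the series 1 / (1 - y)^(r + 1) is expanded in powers of y. Since y has
  no constant term, only powers up to M reach the coefficient of degree M.\<close>

lemma mult_star_power_nth:
  "(h * star q s ^ Suc r) $ M = (\<Sum>j\<le>M. real (j + r choose r) * q ^ j * (h * s ^ j) $ (M - j))"
proof -
  let ?y = "fps_const q * fps_X * s"
  have y0: "?y $ 0 = 0" by simp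
  have yj: "?y ^ j = fps_const (q ^ j) * (fps_X ^ j * s ^ j)" for j
    by (simp add: power_mult_distrib fps_const_power mult_ac)
  \<comment> \<open>The bound M is used for every n, so that the double sum below has independent
    ranges and can be swapped.\<close>
  have "(star q s ^ Suc r) $ n = (\<Sum>j\<le>M. real (j + r choose r) * (?y ^ j) $ n)" if "n \<le> M" for n
  proof -
    have "(star q s ^ Suc r) $ n = (\<Sum>j=0..n. real (j + r choose r) * (?y ^ j) $ n)"
      unfolding star_def fps_compose_power[OF y0] fps_compose_nth geo_power_nth by simp
    also have "\<dots> = (\<Sum>j\<le>M. real (j + r choose r) * (?y ^ j) $ n)"
      using that startsby_zero_power_prefix[OF y0] by (intro sum.mono_neutral_left) auto
    finally show ?thesis .
  qed
  then have "(h * star q s ^ Suc r) $ M =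
      (\<Sum>i=0..M. \<Sum>j\<le>M. real (j + r choose r) * (h $ i * (?y ^ j) $ (M - i)))"
    unfolding fps_mult_nth sum_distrib_left by (intro sum.cong refl) (simp add: sum_distrib_left mult_ac)
  also have "\<dots> = (\<Sum>j\<le>M. real (j + r choose r) * (h * ?y ^ j) $ M)"
    unfolding fps_mult_nth[of h "_ ^ _"] sum_distrib_left by (rule sum.swap)
  also have "\<dots> = (\<Sum>j\<le>M. real (j + r choose r) * q ^ j * (h * s ^ j) $ (M - j))"
  proof (intro sum.cong refl)
    fix j assume "j \<in> {..M}"
    have "h * ?y ^ j = fps_const (q ^ j) * (fps_X ^ j * (h * s ^ j))"
      unfolding yj by (simp add: mult_ac)
    with \<open>j \<in> {..M}\<close> show "real (j + r choose r) * (h * ?y ^ j) $ M =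
        real (j + r choose r) * q ^ j * (h * s ^ j) $ (M - j)"
      by (simp only: fps_mult_left_const_nth fps_X_power_mult_nth) simp
  qed
  finally show ?thesis .
qed

text \<open>Here j failures separate j + 1 blocks of fewer than k successes, which gives A(j + 1, k,
  n - j); its inner binomial simplifies to the one in \<open>P0\<close>.\<close>

lemma sum_star_nth:
  assumes "k \<ge> 1"
  shows "(segment p 0 k * star q (segment p 0 k)) $ n = P0 (int k) p q (int n)"
proof -
  let ?s = "segment p 0 k"
  have "(?s * star q ?s) $ n = (\<Sum>j\<le>n. q ^ j * (?s ^ Suc j) $ (n - j))"
    using mult_star_power_nth[of ?s q ?s 0 n] by simp
  also have "\<dots> = (\<Sum>j\<le>n. p ^ (n - j) * q ^ j * A (int (Suc j)) (int k) (int (n - j)))"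
    using assms by (intro sum.cong refl) (subst segment_power_nth, auto)
  also have "\<dots> = P0 (int k) p q (int n)"
    unfolding P0_def sum_int_from_0 A_def
    by (intro sum.cong refl arg_cong2[where f = "(*)"])
       (auto simp: power_int_def nat_diff_distrib of_nat_diff mult_ac add_ac algebra_simps intro!: sum.cong)
  finally show ?thesis by simp
qed

lemma Suc_ge_one: "1 \<le> Suc j"
  by simp

section \<open>Coefficients of chains of r runs: the formulas \<open>B\<close> and
  \<open>C\<close>\<close>

context
  fixes k g t :: nat and p q :: real
  assumes k: "k \<ge> 1" and kt: "k \<le> t"
begin

lemma run_power:
  "segment p k (Suc t) ^ r = fps_const (p ^ (k * r)) * (fps_X ^ (k * r) * segment p 0 (t - k + 1) ^ r)"
  using kt segment_shift[of p k "t - k + 1"]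
  by (simp add: power_mult_distrib fps_const_power mult_ac flip: power_mult)

text \<open>Each of the r runs is followed by a complete gap, and a short block ends the word. Among
  the u = j + r failures, r open gaps and j end short blocks, so there are j + 1 short blocks; v is
  the total excess of the run lengths over k.\<close>

lemma B_eq:
  assumes r: "r \<ge> 1"
  shows "((fps_const q * fps_X ^ g * segment p k (Suc t)) ^ r *
            segment p 0 k * star q (segment p 0 k) ^ Suc r) $ n =
         B (int k) (int g) p q (int r) (int t) (int n)"
    (is "?F $ n = _")
proof -
  let ?E = "segment p 0 (t - k + 1)" and ?s = "segment p 0 k"
  \<comment> \<open>The least number of trials taken by r runs of length k with their gaps. For n <
    d the range of u in \<open>B\<close> is empty.\<close>
  define d where "d = (g + k) * r"
  have F: "?F = fps_const (q ^ r * p ^ (k * r)) * (fps_X ^ d * (?E ^ r * ?s * star q ?s ^ Suc r))"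
    unfolding power_mult_distrib run_power
    by (simp add: d_def algebra_simps power_add fps_const_power flip: power_mult fps_const_mult)
  have N: "int n - int r * (int g - 1) - int k * int r = int n - int d + int r"
    by (simp add: d_def algebra_simps)
  show ?thesis
  proof (cases "n < d")
    case True
    then show ?thesis
      unfolding F B_def Let_def N by (simp add: fps_X_power_mult_nth)
  next
    case False
    define M where "M = n - d"
    have n: "int n - int d = int M" using False by (simp add: M_def)
    have n': "int n - int r * (int g - 1) = int M + int k * int r + int r" using N n by simp
    let ?f = "\<lambda>j. real (j + r choose r) * q ^ (j + r) * p ^ (k * r + (M - j)) *
       (\<Sum>v = 0..int (M - j). A (int r) (int (t - k + 1)) v * A (int (Suc j)) (int k) (int (M - j) - v))"
    have "?F $ n = q ^ r * p ^ (k * r) * (?E ^ r * ?s * star q ?s ^ Suc r) $ M"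
      unfolding F using False by (simp only: fps_mult_left_const_nth fps_X_power_mult_nth if_False M_def)
    also have "\<dots> = (\<Sum>j\<le>M. q ^ r * p ^ (k * r) *
        (real (j + r choose r) * q ^ j * (?E ^ r * ?s ^ Suc j) $ (M - j)))"
      unfolding mult_star_power_nth sum_distrib_left by (simp add: mult_ac)
    also have "\<dots> = (\<Sum>j\<le>M. ?f j)"
      unfolding segment_power_mult_nth[OF r le_add2 Suc_ge_one k] by (simp only: power_add mult_ac)
    also have "\<dots> = B (int k) (int g) p q (int r) (int t) (int n)"
      unfolding B_def Let_def N unfolding n n'
    proof (rule sum.reindex_bij_witness[of _ "\<lambda>u. nat (u - int r)" "\<lambda>j. int (j + r)"])
      fix j assume j: "j \<in> {..M}"
      have 1: "int M + int k * int r + int r - int (j + r) = int (k * r + (M - j))"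
        using j by (simp add: of_nat_diff)
      have 2: "int M + int r - int (j + r) = int (M - j)"
        using j by (simp add: of_nat_diff)
      have 3: "int (j + r) - int r + 1 = int (Suc j)" by simp
      have 4: "int t - int k + 1 = int (t - k + 1)" using kt by (simp add: of_nat_diff)
      show "q powi int (j + r) * p powi (int M + int k * int r + int r - int (j + r)) *
         ibinom (int (j + r)) (int r) *
         (\<Sum>v = 0..int M + int r - int (j + r).
             A (int r) (int t - int k + 1) v *
             A (int (j + r) - int r + 1) (int k) (int M + int r - int (j + r) - v)) = ?f j"
        unfolding 1 2 3 4 by (simp only: power_int_of_nat ibinom_def nat_int mult_ac)
    qed auto
    finally show ?thesis .
  qed
qed

text \<open>Now the word ends with its last run, so only r - 1 = m failures open gaps and no short
  block follows: u = j + m failures leave j short blocks.\<close>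

lemma C_eq:
  assumes r: "r \<ge> 1"
  shows "((fps_const q * fps_X ^ g * segment p k (Suc t)) ^ (r - 1) *
            segment p k (Suc t) * star q (segment p 0 k) ^ r) $ n =
         C (int k) (int g) p q (int r) (int t) (int n)"
    (is "?F $ n = _")
proof -
  let ?E = "segment p 0 (t - k + 1)" and ?s = "segment p 0 k"
  obtain m where m: "r = Suc m" using r by (cases r) auto
  define d where "d = g * m + k * r"
  have "?F = fps_const (q ^ m) * (fps_X ^ (g * m) * (segment p k (Suc t) ^ r * star q ?s ^ Suc m))"
    unfolding m by (simp add: power_mult_distrib fps_const_power mult_ac flip: power_mult)
  then have F: "?F = fps_const (q ^ m * p ^ (k * r)) * (fps_X ^ d * (?E ^ r * star q ?s ^ Suc m))"
    unfolding run_power by (simp add: d_def power_add mult_ac flip: fps_const_mult)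
  have N: "int n - (int r - 1) * (int g - 1) - int k * int r = int n - int d + int m"
    by (simp add: d_def m algebra_simps)
  have N': "int n - int k * int r - (int r - 1) * int g = int n - int d"
    by (simp add: d_def m algebra_simps)
  have 4: "int t - int k + 1 = int (t - k + 1)" using kt by (simp add: of_nat_diff)
  have m': "int r - 1 = int m" by (simp add: m)
  show ?thesis
  proof (cases "n < d")
    case True
    \<comment> \<open>The argument of \<open>A\<close> is negative, so its floor bound is negative
      and the sum over s is empty.\<close>
    then have "(int n - int d) div int (t - k + 1) < 0"
      by (intro div_neg_pos_less0) auto
    then have "A (int r) (int (t - k + 1)) (int n - int d) = 0"
      by (simp add: A_def)
    with True show ?thesis
      unfolding F C_def Let_def N N' 4 by (simp add: fps_X_power_mult_nth m)
  next
    case False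
    define M where "M = n - d"
    have n: "int n - int d = int M" using False by (simp add: M_def)
    have n': "int n - int m * (int g - 1) = int M + int k * int r + int m" using N n m' by simp
    have n'': "int n - int m * int g = int (M + k * r)" using N' n m' by simp
    let ?f = "\<lambda>j. real (j + m choose m) * q ^ (j + m) * p ^ (k * r + (M - j)) *
       (\<Sum>v = 0..int (M - j). A (int r) (int (t - k + 1)) v * A (int j) (int k) (int (M - j) - v))"
    have "?F $ n = q ^ m * p ^ (k * r) * (?E ^ r * star q ?s ^ Suc m) $ M"
      unfolding F using False by (simp only: fps_mult_left_const_nth fps_X_power_mult_nth if_False M_def)
    also have "\<dots> = (\<Sum>j\<le>M. q ^ m * p ^ (k * r) *
        (real (j + m choose m) * q ^ j * (?E ^ r * ?s ^ j) $ (M - j)))"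
      unfolding mult_star_power_nth sum_distrib_left by (simp add: mult_ac)
    \<comment> \<open>The term j = 0, without any short block, is split off: the coefficient formula
      for powers of \<open>segment\<close> requires a positive exponent. It becomes the separate
      first summand of \<open>C\<close>.\<close>
    also have "\<dots> = q ^ m * p ^ (k * r) * (?E ^ r) $ M + (\<Sum>j\<in>{1..M}. q ^ m * p ^ (k * r) *
        (real (j + m choose m) * q ^ j * (?E ^ r * ?s ^ j) $ (M - j)))"
      by (simp add: sum.atLeast_Suc_atMost flip: atLeast0AtMost)
    also have "(?E ^ r) $ M = A (int r) (int (t - k + 1)) (int M) * p ^ M"
      using r by (subst segment_power_nth) auto
    also have "(\<Sum>j\<in>{1..M}. q ^ m * p ^ (k * r) *
        (real (j + m choose m) * q ^ j * (?E ^ r * ?s ^ j) $ (M - j))) = (\<Sum>j\<in>{1..M}. ?f j)"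
    proof (intro sum.cong refl)
      fix j assume "j \<in> {1..M}"
      then have j: "1 \<le> j" by simp
      show "q ^ m * p ^ (k * r) * (real (j + m choose m) * q ^ j * (?E ^ r * ?s ^ j) $ (M - j)) = ?f j"
        unfolding segment_power_mult_nth[OF r le_add2 j k] by (simp only: power_add mult_ac)
    qed
    also have "\<dots> = (\<Sum>u = int r..int M + int m. q powi u * p powi (int M + int k * int r + int m - u) *
        ibinom u (int m) * (\<Sum>v = 0..int M + int m - u. A (int r) (int (t - k + 1)) v *
          A (u - int r + 1) (int k) (int M + int m - u - v)))"
    proof (rule sum.reindex_bij_witness[of _ "\<lambda>u. nat (u - int m)" "\<lambda>j. int (j + m)"])
      fix j assume j: "j \<in> {1..M}"
      have 1: "int M + int k * int r + int m - int (j + m) = int (k * r + (M - j))"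
        using j by (simp add: of_nat_diff)
      have 2: "int M + int m - int (j + m) = int (M - j)"
        using j by (simp add: of_nat_diff)
      have 3: "int (j + m) - int r + 1 = int j" by (simp add: m)
      show "q powi int (j + m) * p powi (int M + int k * int r + int m - int (j + m)) *
         ibinom (int (j + m)) (int m) *
         (\<Sum>v = 0..int M + int m - int (j + m).
             A (int r) (int (t - k + 1)) v *
             A (int (j + m) - int r + 1) (int k) (int M + int m - int (j + m) - v)) = ?f j"
        unfolding 1 2 3 by (simp only: power_int_of_nat ibinom_def nat_int mult_ac)
    qed (auto simp: m)
    also have "q ^ m * p ^ (k * r) * (A (int r) (int (t - k + 1)) (int M) * p ^ M) =
        A (int r) (int (t - k + 1)) (int M) * q powi int m * p powi int (M + k * r)"
      by (simp only: power_int_of_nat power_add mult_ac)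
    finally show ?thesis
      unfolding C_def Let_def N N' 4 unfolding n m' n' n'' .
  qed
qed

end

text \<open>The sum over w in the theorem may reach beyond n, whereas a power series has no
  coefficient there; this lemma supplies the zeros.\<close>

lemma C_neg:
  assumes "g \<ge> 1" "k \<le> t" "r \<ge> 1" "N < 0"
  shows "C (int k) (int g) p q (int r) (int t) N = 0"
proof -
  have "(int r - 1) * (int g - 1) \<ge> 0" "(int r - 1) * int g \<ge> 0"
    using assms by auto
  moreover have "int k * int r \<ge> 0" by simp
  ultimately have neg: "N - (int r - 1) * (int g - 1) - int k * int r < int r"
      "N - int k * int r - (int r - 1) * int g < 0"
    using assms by linarith+
  have "(N - int k * int r - (int r - 1) * int g) div (int t - int k + 1) < 0"
    using neg(2) assms(2) by (intro div_neg_pos_less0) auto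
  then have "A (int r) (int t - int k + 1) (N - int k * int r - (int r - 1) * int g) = 0"
    by (simp add: A_def)
  with neg(1) show ?thesis
    unfolding C_def Let_def by simp
qed

subsection \<open>The chain of success runs\<close>

text \<open>Some maximal block starts at the least start of any block, so the first maximal block
  starts there too. Maximality then only restricts the right end.\<close>

lemma first_block_iff:
  "first_block x n k c a b \<longleftrightarrow>
     success_block x n k c a b \<and> (b = n \<or> \<not> x (Suc b)) \<and>
     (\<forall>a' b'. success_block x n k c a' b' \<longrightarrow> a \<le> a')"
  (is "?L \<longleftrightarrow> ?R")
proof
  assume L: ?L
  then have blk: "success_block x n k c a b"
    by (simp add: first_block_def maximal_block_def)
  have "b = n \<or> \<not> x (Suc b)"
  proof (rule ccontr)
    assume "\<not> (b = n \<or> \<not> x (Suc b))"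
    with blk have "success_block x n k c a (Suc b)"
      by (auto simp: success_block_def le_Suc_eq)
    moreover have "\<forall>a' b'. success_block x n k c a' b' \<and> a' \<le> a \<and> b \<le> b' \<longrightarrow> a' = a \<and> b' = b"
      using L unfolding first_block_def maximal_block_def by blast
    ultimately show False
      by (metis Suc_n_not_le_n le_Suc_eq order_refl)
  qed
  moreover have "a \<le> a'" if "success_block x n k c a' b'" for a' b'
  proof -
    \<comment> \<open>The leftmost start with its furthest end gives a maximal block, to which the
      minimality of a applies.\<close>
    define a0 where "a0 = (LEAST a. \<exists>b. success_block x n k c a b)"
    define b0 where "b0 = (GREATEST b. success_block x n k c a0 b)"
    have "\<exists>b. success_block x n k c a0 b"
      unfolding a0_def by (rule LeastI) (use that in blast)
    moreover have bound: "y \<le> n" if "success_block x n k c a0 y" for y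
      using that by (simp add: success_block_def)
    ultimately have "success_block x n k c a0 b0"
      unfolding b0_def by (blast intro: GreatestI_ex_nat)
    moreover have least: "a0 \<le> a''" if "success_block x n k c a'' b''" for a'' b''
      unfolding a0_def by (rule Least_le) (use that in blast)
    moreover have "b'' \<le> b0" if "success_block x n k c a0 b''" for b''
      unfolding b0_def using that bound by (rule Greatest_le_nat)
    ultimately have "maximal_block x n k c a0 b0"
      unfolding maximal_block_def by (metis antisym)
    then have "a \<le> a0"
      using L by (auto simp: first_block_def)
    with least that show ?thesis
      by (meson order_trans)
  qed
  ultimately show ?R
    using blk by blast
next
  assume R: ?R
  have "a' = a \<and> b' = b" if "success_block x n k c a' b'" "a' \<le> a" "b \<le> b'" for a' b'
  proof -
    have "a' = a" using R that by (meson antisym)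
    moreover have "b' \<le> b"
    proof (rule ccontr)
      assume "\<not> b' \<le> b"
      then have "Suc b \<in> {a'..b'}" "b < n"
        using that R by (auto simp: success_block_def)
      with that R show False
        by (auto simp: success_block_def)
    qed
    ultimately show ?thesis using that by simp
  qed
  with R show ?L
    unfolding first_block_def maximal_block_def by blast
qed

text \<open>
  \<open>success_run\<close> appends runs at the end of the chain; \<open>run_from\<close> builds the same chain from the front,
  which fits the recursion over the remaining trials.
\<close>

inductive run_from :: "(nat \<Rightarrow> bool) \<Rightarrow> nat \<Rightarrow> nat \<Rightarrow> nat \<Rightarrow> nat \<Rightarrow> nat \<Rightarrow> nat \<Rightarrow> bool"
  for x n k g where
  head: "first_block x n k c a b \<Longrightarrow> run_from x n k g c a b"
| tail: "first_block x n k c a b \<Longrightarrow> run_from x n k g (b + g) a' b' \<Longrightarrow> run_from x n k g c a' b'"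

lemma run_from_snoc:
  "run_from x n k g c a b \<Longrightarrow> first_block x n k (b + g) a' b' \<Longrightarrow> run_from x n k g c a' b'"
  by (induction rule: run_from.induct) (auto intro: run_from.intros)

text \<open>The condition on c says that c is a position from which \<open>success_run\<close> can
  continue; each \<open>tail\<close> step preserves it.\<close>

lemma success_run_of_run_from:
  assumes "run_from x n k g c a' b'" "c = 0 \<or> (\<exists>j a b. success_run x n k g j a b \<and> c = b + g)"
  shows "\<exists>j. success_run x n k g j a' b'"
  using assms
proof (induction rule: run_from.induct)
  case (head c a b)
  then show ?case by (blast intro: success_run.intros)
next
  case (tail c a b a' b')
  then have "\<exists>j. success_run x n k g j a b" by (blast intro: success_run.intros)
  with tail.IH show ?case by blast
qed

lemma ex_success_run_iff: "(\<exists>j. success_run x n k g j a b) \<longleftrightarrow> run_from x n k g 0 a b"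
proof
  assume "\<exists>j. success_run x n k g j a b"
  then obtain j where "success_run x n k g j a b" by blast
  then show "run_from x n k g 0 a b"
    by (induction rule: success_run.induct) (auto intro: head run_from_snoc)
qed (simp add: success_run_of_run_from)

lemma run_from_length:
  "run_from x n k g c a b \<Longrightarrow> c < a \<and> a \<le> b \<and> b \<le> n \<and> k \<le> b + 1 - a"
proof (induction rule: run_from.induct)
  case (tail c a b a' b')
  then show ?case by (auto simp: first_block_iff success_block_def)
qed (auto simp: first_block_iff success_block_def)

text \<open>
  In \<open>runs_le k g t d xs\<close> the trials \<open>xs\<close> are preceded by \<open>d\<close> successes that count towards the current
  run. A failure after at least \<open>k\<close> successes opens a gap, whose other \<open>g - 1\<close> trials are dropped.
\<close>

fun runs_le :: "nat \<Rightarrow> nat \<Rightarrow> nat \<Rightarrow> nat \<Rightarrow> bool list \<Rightarrow> bool" where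
  "runs_le k g t d [] \<longleftrightarrow> d \<le> t"
| "runs_le k g t d (True # xs) \<longleftrightarrow> runs_le k g t (Suc d) xs"
| "runs_le k g t d (False # xs) \<longleftrightarrow>
     (if d < k then runs_le k g t 0 xs else d \<le> t \<and> runs_le k g t 0 (drop (g - 1) xs))"

text \<open>No block can start before trial c + 1, and the d successes there already form a block;
  the failure or the end of the trials fixes its last trial.\<close>

lemma first_block_of_prefix:
  assumes "k \<ge> 1" "k \<le> d" "c + d \<le> n" "\<forall>i\<in>{c<..c + d}. x i" "c + d = n \<or> \<not> x (Suc (c + d))"
  shows "first_block x n k c a b \<longleftrightarrow> a = Suc c \<and> b = c + d"
proof
  have blk: "success_block x n k c (Suc c) (c + d)"
    using assms by (auto simp: success_block_def)
  show "first_block x n k c a b" if "a = Suc c \<and> b = c + d"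
    unfolding first_block_iff using that blk assms(5) by (auto simp: success_block_def)
  assume fb: "first_block x n k c a b"
  then have ab: "c < a" "a \<le> Suc c" "a \<le> b" "b \<le> n" "\<forall>i\<in>{a..b}. x i" "b = n \<or> \<not> x (Suc b)"
    using blk unfolding first_block_iff success_block_def by blast+
  then have a: "a = Suc c" by simp
  moreover have "b = c + d"
  proof (rule linorder_cases[of b "c + d"])
    assume "b < c + d"
    then have "Suc b \<in> {c<..c + d}" "b \<noteq> n" using ab assms(3) by auto
    with ab(6) assms(4) show ?thesis by blast
  next
    assume "c + d < b"
    then have "Suc (c + d) \<in> {a..b}" "c + d \<noteq> n" using ab a by auto
    with ab(5) assms(5) show ?thesis by blast
  qed
  ultimately show "a = Suc c \<and> b = c + d" by blast
qed

text \<open>A block starting at or before the failure is too long to stop before it, so it would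
  contain the failure.\<close>

lemma success_block_skip:
  assumes "d < k" "\<not> x (Suc (c + d))"
  shows "success_block x n k c = success_block x n k (Suc (c + d))"
proof (intro ext)
  fix a b
  have "Suc (c + d) < a" if "success_block x n k c a b"
  proof (rule ccontr)
    assume "\<not> Suc (c + d) < a"
    then have "Suc (c + d) \<in> {a..b}"
      using that assms(1) by (auto simp: success_block_def)
    with that assms(2) show False by (auto simp: success_block_def)
  qed
  then show "success_block x n k c a b = success_block x n k (Suc (c + d)) a b"
    by (auto simp: success_block_def)
qed

lemma run_from_iff:
  "run_from x n k g c a' b' \<longleftrightarrow>
    (\<exists>a b. first_block x n k c a b \<and> ((a' = a \<and> b' = b) \<or> run_from x n k g (b + g) a' b'))"
  by (subst run_from.simps) blast

text \<open>Induction on the number of unread trials: c is where the current search starts and d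
  counts the successes read since. A gap may carry c beyond n, but then d = 0. The bound
  \<open>k \<le> Suc t\<close> admits t = k - 1.\<close>

lemma runs_le_iff:
  assumes k: "k \<ge> 1" and g: "g \<ge> 1" and t: "k \<le> Suc t"
  assumes "d = 0 \<or> c + d \<le> n" "\<forall>i\<in>{c<..c + d}. x i"
  shows "runs_le k g t d (map x [Suc (c + d)..<Suc n]) \<longleftrightarrow>
    (\<forall>a b. run_from x n k g c a b \<longrightarrow> b + 1 - a \<le> t)"
  using assms(4,5)
proof (induction "n - (c + d)" arbitrary: c d rule: less_induct)
  case less
  show ?case
  proof (cases "c + d < n")
    case False
    show ?thesis
    proof (cases "d < k")
      case True
      \<comment> \<open>No run exists, and the list side holds because d < k \<le> t + 1.\<close>
      have "\<not> run_from x n k g c a b" for a b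
        using run_from_length[of x n k g c a b] True False less.prems(1) by auto
      with True False t show ?thesis by auto
    next
      case dk: False
      with k less.prems False have n: "c + d = n" by auto
      have "\<not> run_from x n k g (c + d + g) a b" for a b
        using run_from_length[of x n k g "c + d + g" a b] n by auto
      then have "run_from x n k g c a b \<longleftrightarrow> a = Suc c \<and> b = c + d" for a b
        using first_block_of_prefix[of k d c n x] k dk n less.prems
        by (subst run_from_iff) auto
      with n show ?thesis by auto
    qed
  next
    case True
    then have upt: "[Suc (c + d)..<Suc n] = Suc (c + d) # [Suc (Suc (c + d))..<Suc n]"
      by (simp add: upt_conv_Cons del: upt_Suc)
    show ?thesis
    proof (cases "x (Suc (c + d))")
      case x: True
      have "runs_le k g t (Suc d) (map x [Suc (c + Suc d)..<Suc n]) \<longleftrightarrow>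
          (\<forall>a b. run_from x n k g c a b \<longrightarrow> b + 1 - a \<le> t)"
      proof (rule less.hyps)
        show "\<forall>i\<in>{c<..c + Suc d}. x i"
          using less.prems x by (auto simp: le_Suc_eq)
      qed (use True in auto)
      with x show ?thesis unfolding upt by (simp del: upt_Suc)
    next
      case x: False
      show ?thesis
      proof (cases "d < k")
        case dk: True
        \<comment> \<open>The block was too short, so the search restarts after the failure.\<close>
        have "first_block x n k c = first_block x n k (Suc (c + d))"
          unfolding fun_eq_iff first_block_iff success_block_skip[of d k x c n, OF dk x] by simp
        then have "run_from x n k g c a b \<longleftrightarrow> run_from x n k g (Suc (c + d)) a b" for a b
          by (subst (1 2) run_from_iff) simp
        moreover have "runs_le k g t 0 (map x [Suc (Suc (c + d) + 0)..<Suc n]) \<longleftrightarrow>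
          (\<forall>a b. run_from x n k g (Suc (c + d)) a b \<longrightarrow> b + 1 - a \<le> t)"
          by (rule less.hyps) (use True in auto)
        ultimately show ?thesis
          using x dk unfolding upt by (simp del: upt_Suc)
      next
        case dk: False
        have fb: "first_block x n k c a b \<longleftrightarrow> a = Suc c \<and> b = c + d" for a b
          using first_block_of_prefix[of k d c n x] k dk x True less.prems by auto
        have "run_from x n k g c a b \<longleftrightarrow>
            (a = Suc c \<and> b = c + d) \<or> run_from x n k g (c + d + g) a b" for a b
          by (subst run_from_iff) (auto simp: fb)
        then have "(\<forall>a b. run_from x n k g c a b \<longrightarrow> b + 1 - a \<le> t) \<longleftrightarrow>
          d \<le> t \<and> (\<forall>a b. run_from x n k g (c + d + g) a b \<longrightarrow> b + 1 - a \<le> t)"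
          by auto
        moreover have "runs_le k g t 0 (map x [Suc (c + d + g + 0)..<Suc n]) \<longleftrightarrow>
          (\<forall>a b. run_from x n k g (c + d + g) a b \<longrightarrow> b + 1 - a \<le> t)"
          by (rule less.hyps) (use True g in auto)
        \<comment> \<open>The failure just read is itself the first trial of the gap, so only g - 1
          more are dropped.\<close>
        moreover have "drop (g - 1) (map x [Suc (Suc (c + d))..<Suc n]) =
            map x [Suc (c + d + g)..<Suc n]"
          using g by (simp add: drop_map drop_upt del: upt_Suc)
        ultimately show ?thesis
          using x dk unfolding upt by (simp del: upt_Suc)
      qed
    qed
  qed
qed

lemma longest_run_le_iff:
  "longest_run x n k g \<le> t \<longleftrightarrow> (\<forall>a b. run_from x n k g 0 a b \<longrightarrow> b + 1 - a \<le> t)"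
proof -
  have "finite {l. \<exists>j a b. success_run x n k g j a b \<and> l = b + 1 - a}" (is "finite ?L")
  proof (rule finite_subset)
    show "?L \<subseteq> {..n}"
    proof
      fix l assume "l \<in> ?L"
      then obtain a b where "l = b + 1 - a" "run_from x n k g 0 a b"
        by (auto simp flip: ex_success_run_iff)
      then show "l \<in> {..n}" using run_from_length[of x n k g 0 a b] by auto
    qed
  qed simp
  then have "longest_run x n k g \<le> t \<longleftrightarrow> (\<forall>l\<in>?L. l \<le> t)"
    by (simp add: longest_run_def)
  then show ?thesis
    by (auto simp flip: ex_success_run_iff)
qed

text \<open>Every success run has length at least k, so absence of runs is the event of the length
  bound with t = k - 1.\<close>

lemma ex_success_run_iff_long:
  assumes "k \<ge> 1"
  shows "(\<exists>j a b. success_run x n k g j a b) \<longleftrightarrow>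
    \<not> (\<forall>a b. run_from x n k g 0 a b \<longrightarrow> b + 1 - a \<le> k - 1)"
proof -
  have "\<not> b + 1 - a \<le> k - 1" if "run_from x n k g 0 a b" for a b
    using run_from_length[OF that] assms by linarith
  moreover have "(\<exists>j a b. success_run x n k g j a b) \<longleftrightarrow> (\<exists>a b. run_from x n k g 0 a b)"
    by (auto simp flip: ex_success_run_iff)
  ultimately show ?thesis by blast
qed

subsection \<open>Probabilities of sets of words\<close>

definition word_prob :: "real \<Rightarrow> real \<Rightarrow> nat \<Rightarrow> (bool list \<Rightarrow> bool) \<Rightarrow> real" where
  "word_prob p q n F = (\<Sum>l | length l = n \<and> F l. \<Prod>b\<leftarrow>l. if b then p else q)"

lemma finite_words: "finite {l :: bool list. length l = n \<and> F l}"
  using finite_lists_length_eq[of "UNIV :: bool set" n] by (rule finite_subset[rotated]) auto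

lemma word_prob_0: "word_prob p q 0 F = of_bool (F [])"
proof -
  have "{l. length l = 0 \<and> F l} = (if F [] then {[]} else {})" by auto
  then show ?thesis by (simp add: word_prob_def)
qed

lemma word_prob_Suc:
  "word_prob p q (Suc n) F = p * word_prob p q n (\<lambda>l. F (True # l)) + q * word_prob p q n (\<lambda>l. F (False # l))"
proof -
  let ?S = "\<lambda>b. (#) b ` {l. length l = n \<and> F (b # l)}"
  have "{l. length l = Suc n \<and> F l} = ?S True \<union> ?S False"
  proof (rule set_eqI)
    fix l show "l \<in> {l. length l = Suc n \<and> F l} \<longleftrightarrow> l \<in> ?S True \<union> ?S False"
    proof (cases l)
      case (Cons b l')
      then show ?thesis by (cases b) auto
    qed auto
  qed
  moreover have "?S True \<inter> ?S False = {}" by auto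
  ultimately show ?thesis
    by (simp add: word_prob_def sum.union_disjoint finite_words sum.reindex sum_distrib_left)
qed

text \<open>Dropped letters are unrestricted and have total weight p + q = 1 each. Truncated
  subtraction covers a gap cut off by the end.\<close>

lemma word_prob_drop:
  assumes "p + q = 1"
  shows "word_prob p q n (\<lambda>l. F (drop m l)) = word_prob p q (n - m) F"
proof (induction m arbitrary: n)
  case (Suc m)
  show ?case
  proof (cases n)
    case (Suc n')
    then show ?thesis
      using Suc.IH[of n'] assms by (simp add: word_prob_Suc flip: distrib_right)
  qed (simp add: word_prob_0)
qed simp

text \<open>The event is a disjoint union of the events of seeing one fixed word, and independence
  makes the probability of each a product.\<close>

lemma (in prob_space) prob_word:
  assumes indep: "indep_vars (\<lambda>_. count_space UNIV) X {1..n}"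
    and p: "\<And>i. i \<in> {1..n} \<Longrightarrow> prob {\<omega> \<in> space M. X i \<omega>} = p"
    and n: "n \<ge> 1" and q: "q = 1 - p"
  shows "prob {\<omega> \<in> space M. F (map (\<lambda>i. X i \<omega>) [1..<Suc n])} = word_prob p q n F"
proof -
  define E where "E l = {\<omega> \<in> space M. map (\<lambda>i. X i \<omega>) [1..<Suc n] = l}" for l
  have rv: "X i \<in> measurable M (count_space UNIV)" if "i \<in> {1..n}" for i
    using indep that by (auto simp: indep_vars_def)
  then have ev: "X i -` B \<inter> space M \<in> events" if "i \<in> {1..n}" for i B
    using that by (auto intro: measurable_sets)
  \<comment> \<open>Trial i corresponds to list index i - 1. The index set is nonempty as n \<ge> 1,
    which keeps the intersection inside the space.\<close>
  have E_eq: "E l = (\<Inter>i\<in>{1..n}. X i -` {l ! (i - 1)} \<inter> space M)" if "length l = n" for l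
  proof -
    have "map (\<lambda>i. X i \<omega>) [1..<Suc n] = l \<longleftrightarrow> (\<forall>i\<in>{1..n}. X i \<omega> = l ! (i - 1))" for \<omega>
    proof -
      have "map (\<lambda>i. X i \<omega>) [1..<Suc n] = l \<longleftrightarrow> (\<forall>j<n. X (Suc j) \<omega> = l ! j)"
        using that by (auto simp: list_eq_iff_nth_eq simp del: upt_Suc)
      also have "\<dots> \<longleftrightarrow> (\<forall>i\<in>{1..n}. X i \<omega> = l ! (i - 1))"
      proof
        assume *: "\<forall>i\<in>{1..n}. X i \<omega> = l ! (i - 1)"
        show "\<forall>j<n. X (Suc j) \<omega> = l ! j"
          using *[THEN bspec, of "Suc _"] by auto
      next
        assume *: "\<forall>j<n. X (Suc j) \<omega> = l ! j"
        show "\<forall>i\<in>{1..n}. X i \<omega> = l ! (i - 1)"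
        proof
          fix i assume "i \<in> {1..n}"
          then show "X i \<omega> = l ! (i - 1)" using * by (cases i) auto
        qed
      qed
      finally show ?thesis .
    qed
    then show ?thesis using n by (auto simp: E_def)
  qed
  have E_ev: "E l \<in> events" if "length l = n" for l
    unfolding E_eq[OF that] using n ev by (intro sets.finite_INT) auto
  have single: "prob (X i -` {b} \<inter> space M) = (if b then p else q)" if i: "i \<in> {1..n}" for i b
  proof -
    have T: "X i -` {True} \<inter> space M = {\<omega> \<in> space M. X i \<omega>}" by auto
    have "X i -` {False} \<inter> space M = space M - (X i -` {True} \<inter> space M)" by auto
    then have "prob (X i -` {False} \<inter> space M) = 1 - p"
      using prob_compl[OF ev[OF i, of "{True}"]] p[OF i] T by simp
    with p[OF i] T q show ?thesis by (cases b) auto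
  qed
  have E_prob: "prob (E l) = (\<Prod>b\<leftarrow>l. if b then p else q)" if l: "length l = n" for l
  proof -
    have "prob (E l) = (\<Prod>i\<in>{1..n}. prob (X i -` {l ! (i - 1)} \<inter> space M))"
      unfolding E_eq[OF l] using n by (intro indep_varsD[OF indep]) auto
    also have "\<dots> = (\<Prod>i\<in>{1..n}. if l ! (i - 1) then p else q)"
      by (intro prod.cong refl single)
    also have "\<dots> = (\<Prod>i\<in>{0..<n}. if l ! i then p else q)"
      by (rule prod.reindex_bij_witness[of _ Suc "\<lambda>i. i - 1"]) auto
    also have "\<dots> = (\<Prod>b\<leftarrow>l. if b then p else q)"
      using l by (simp add: prod.list_conv_set_nth)
    finally show ?thesis .
  qed
  have "{\<omega> \<in> space M. F (map (\<lambda>i. X i \<omega>) [1..<Suc n])} = (\<Union>l\<in>{l. length l = n \<and> F l}. E l)"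
    by (auto simp: E_def simp del: upt_Suc)
  also have "prob \<dots> = (\<Sum>l | length l = n \<and> F l. prob (E l))"
  proof (intro finite_measure_finite_Union finite_words)
    show "E ` {l. length l = n \<and> F l} \<subseteq> events"
      using E_ev by blast
    show "disjoint_family_on E {l. length l = n \<and> F l}"
      by (auto simp: disjoint_family_on_def E_def)
  qed
  also have "\<dots> = word_prob p q n F"
    unfolding word_prob_def by (intro sum.cong) (auto simp: E_prob)
  finally show ?thesis .
qed

subsection \<open>The functional equation\<close>

definition state_prob :: "nat \<Rightarrow> nat \<Rightarrow> nat \<Rightarrow> real \<Rightarrow> real \<Rightarrow> nat \<Rightarrow> nat \<Rightarrow> real" where
  "state_prob k g t p q d n = word_prob p q n (runs_le k g t d)"

lemma state_prob_0: "state_prob k g t p q d 0 = of_bool (d \<le> t)"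
  by (simp add: state_prob_def word_prob_0)

lemma state_prob_Suc:
  assumes "p + q = 1"
  shows "state_prob k g t p q d (Suc n) = p * state_prob k g t p q (Suc d) n +
    q * (if d < k then state_prob k g t p q 0 n
         else if d \<le> t then state_prob k g t p q 0 (n - (g - 1)) else 0)"
proof -
  have "word_prob p q n (\<lambda>l. False) = 0" by (simp add: word_prob_def)
  then show ?thesis
    using word_prob_drop[OF assms, of n "runs_le k g t 0" "g - 1"]
    by (auto simp: state_prob_def word_prob_Suc)
qed

text \<open>Either all n trials succeed, or the first failure comes after l < n successes. The
  induction needs arbitrary d because each success raises it.\<close>

lemma state_prob_unroll:
  assumes "p + q = 1"
  shows "state_prob k g t p q d n = p ^ n * of_bool (d + n \<le> t) +
    (\<Sum>l<n. p ^ l * q * (if d + l < k then state_prob k g t p q 0 (n - Suc l)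
         else if d + l \<le> t then state_prob k g t p q 0 (n - l - 1 - (g - 1)) else 0))"
proof (induction n arbitrary: d)
  case 0
  then show ?case by (simp add: state_prob_0)
next
  case (Suc n)
  let ?f = "\<lambda>d n l. p ^ l * q * (if d + l < k then state_prob k g t p q 0 (n - Suc l)
         else if d + l \<le> t then state_prob k g t p q 0 (n - l - 1 - (g - 1)) else 0)"
  have "?f d (Suc n) (Suc l) = p * ?f (Suc d) n l" for l
    by simp
  then have shift: "(\<Sum>l<n. ?f d (Suc n) (Suc l)) = p * (\<Sum>l<n. ?f (Suc d) n l)"
    unfolding sum_distrib_left by (rule sum.cong[OF refl])
  show ?case
    unfolding state_prob_Suc[OF assms] Suc.IH[of "Suc d"] sum.lessThan_Suc_shift shift
    by (simp add: algebra_simps)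
qed

lemma state_prob_fps:
  assumes pq: "p + q = 1" and g: "g \<ge> 1" and kt: "k \<le> Suc t"
  defines "T \<equiv> Abs_fps (state_prob k g t p q 0)"
  shows "T = segment p 0 k * (1 + fps_const q * fps_X * T) +
    segment p k (Suc t) * (1 + fps_const q * (\<Sum>w=1..g-1. fps_X ^ w) + fps_const q * fps_X ^ g * T)"
    (is "_ = _ * ?U + _ * ?V")
proof (rule fps_ext)
  fix n
  let ?a = "state_prob k g t p q 0"
  have U: "?U $ m = (if m = 0 then 1 else q * ?a (m - 1))" for m
    by (simp add: T_def mult.assoc)
  \<comment> \<open>For 0 < m < g the truncated m - g is 0 and \<open>?a 0\<close> is 1, which
    matches the terms for incomplete gaps.\<close>
  have V: "?V $ m = (if m = 0 then 1 else q * ?a (m - g))" for m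
  proof -
    have "(\<Sum>w=1..g-1. fps_X ^ w :: real fps) $ m = (\<Sum>w=1..g-1. if w = m then 1 else 0)"
      unfolding fps_sum_nth fps_X_power_nth by (intro sum.cong) auto
    also have "\<dots> = of_bool (1 \<le> m \<and> m < g)"
      using g by auto
    finally have "(\<Sum>w=1..g-1. fps_X ^ w :: real fps) $ m = of_bool (1 \<le> m \<and> m < g)" .
    then show ?thesis
      using g by (auto simp: T_def mult.assoc fps_X_power_mult_nth state_prob_0)
  qed
  have "(segment p 0 k * ?U + segment p k (Suc t) * ?V) $ n =
      (\<Sum>l=0..n. segment p 0 k $ l * ?U $ (n - l) + segment p k (Suc t) $ l * ?V $ (n - l))"
    by (simp only: fps_add_nth fps_mult_nth sum.distrib)
  also have "\<dots> = (\<Sum>l<Suc n. segment p 0 k $ l * ?U $ (n - l) + segment p k (Suc t) $ l * ?V $ (n - l))"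
    by (intro sum.cong) auto
  also have "\<dots> = p ^ n * of_bool (n \<le> t) +
    (\<Sum>l<n. p ^ l * q * (if l < k then ?a (n - Suc l)
         else if l \<le> t then ?a (n - l - 1 - (g - 1)) else 0))"
  proof -
    have "segment p 0 k $ l * ?U $ (n - l) + segment p k (Suc t) $ l * ?V $ (n - l) =
        p ^ l * q * (if l < k then ?a (n - Suc l) else if l \<le> t then ?a (n - l - 1 - (g - 1)) else 0)"
      if "l < n" for l
      using that g unfolding U V segment_nth by simp
    \<comment> \<open>The term l = n is the word of successes only; \<open>k \<le> Suc t\<close>
      makes the two segments cover exactly the lengths up to t.\<close>
    moreover have "segment p 0 k $ n * ?U $ (n - n) + segment p k (Suc t) $ n * ?V $ (n - n) =
        p ^ n * of_bool (n \<le> t)"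
      using kt unfolding U V segment_nth by auto
    ultimately show ?thesis
      unfolding sum.lessThan_Suc by simp
  qed
  also have "\<dots> = ?a n"
    unfolding state_prob_unroll[OF pq, of k g t 0 n] add_0_left ..
  finally show "T $ n = (segment p 0 k * ?U + segment p k (Suc t) * ?V) $ n"
    by (simp add: T_def)
qed

section \<open>Solving the functional equation\<close>

lemma segment_empty: "segment p k k = 0"
  by (rule fps_ext) (simp add: segment_nth)

lemma state_prob_no_runs:
  assumes "p + q = 1" "g \<ge> 1" "k \<ge> 1"
  shows "state_prob k g (k - 1) p q 0 n = P0 (int k) p q (int n)"
proof -
  let ?s = "segment p 0 k"
  define T where "T = Abs_fps (state_prob k g (k - 1) p q 0)"
  have "T = ?s * (1 + fps_const q * fps_X * T)"
    using state_prob_fps[of p q g k "k - 1"] assms by (simp add: T_def segment_empty)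
  then have "(1 - fps_const q * fps_X * ?s) * T = ?s"
    by (simp add: algebra_simps)
  moreover have "T = star q ?s * ((1 - fps_const q * fps_X * ?s) * T)"
    using star_inverse[of q ?s] by (simp add: mult_ac)
  ultimately have "T = ?s * star q ?s"
    by (simp only: mult.commute)
  then show ?thesis
    using sum_star_nth[OF assms(3), of p q n] by (metis T_def fps_nth_Abs_fps)
qed

text \<open>The hypothesis on m says that m + 1 runs with m gaps need more than n trials, so m
  iterations of the equation determine the coefficient of degree n.\<close>

lemma state_prob_eq:
  assumes pq: "p + q = 1" and g: "g \<ge> 1" and k: "k \<ge> 1" and kt: "k \<le> t"
    and m: "n + g < Suc m * (k + g)"
  shows "state_prob k g t p q 0 n = P0 (int k) p q (int n) +
    (\<Sum>r=1..m. B (int k) (int g) p q (int r) (int t) (int n) +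
       C (int k) (int g) p q (int r) (int t) (int n) +
       q * (\<Sum>w=1..g-1. C (int k) (int g) p q (int r) (int t) (int n - int w)))"
proof -
  let ?s = "segment p 0 k" and ?r = "segment p k (Suc t)"
  define T where "T = Abs_fps (state_prob k g t p q 0)"
  define W where "W = 1 + fps_const q * (\<Sum>w=1..g-1. fps_X ^ w)"
  define Q where "Q = fps_const q * fps_X ^ g"
  define J where "J = star q ?s"
  define Z where "Z = Q * ?r * J"
  have T: "T = ?s * (1 + fps_const q * fps_X * T) + ?r * (W + Q * T)"
    unfolding T_def W_def Q_def using state_prob_fps[OF pq g] kt by simp
  have "T = J * ((1 - fps_const q * fps_X * ?s) * T)"
    using star_inverse[of q ?s] by (simp add: J_def mult_ac)
  also have "(1 - fps_const q * fps_X * ?s) * T = T - ?s * (fps_const q * fps_X * T)"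
    by (simp add: algebra_simps)
  also have "\<dots> = ?s + ?r * (W + Q * T)"
    by (subst (1) T) (simp add: algebra_simps)
  finally have step: "T = ?s * J + ?r * J * W + Z * T"
    by (simp add: Z_def algebra_simps)
  have expand: "T = ?s * J + (\<Sum>r=1..i. Z ^ r * ?s * J + Z ^ (r - 1) * ?r * J * W) +
      Z ^ i * (?r * J * W + Z * T)" for i
  proof (induction i)
    case 0
    then show ?case using step by (simp add: add.assoc)
  next
    case (Suc i)
    have "Z * T = Z * (?s * J) + Z * (?r * J * W + Z * T)"
      by (subst (1) step) (simp add: algebra_simps)
    then have "Z ^ i * (?r * J * W + Z * T) = Z ^ i * (?r * J * W + (Z * (?s * J) + Z * (?r * J * W + Z * T)))"
      by (rule arg_cong)
    also have "\<dots> = (Z ^ Suc i * ?s * J + Z ^ (Suc i - 1) * ?r * J * W) +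
        Z ^ Suc i * (?r * J * W + Z * T)"
      by (simp add: algebra_simps)
    finally show ?case using Suc.IH by (simp add: add.assoc)
  qed
  \<comment> \<open>The bracket contributes one more factor \<open>?r\<close>, so the remainder is
    divisible by X^(gm + km + k), and this exponent exceeds n.\<close>
  have rem: "(Z ^ m * (?r * J * W + Z * T)) $ n = 0"
  proof -
    have r: "?r = fps_X ^ k * (fps_const (p ^ k) * segment p 0 (t - k + 1))"
      using segment_shift[of p k "t - k + 1"] kt by (simp add: mult_ac)
    have "Z ^ m * (?r * J * W + Z * T) = (Q * ?r * J) ^ m * ?r * (J * (W + Q * T))"
      by (simp add: Z_def algebra_simps)
    also have "\<dots> = fps_X ^ (g * m + k * m + k) * ((fps_const q * (fps_const (p ^ k) * segment p 0 (t - k + 1)) * J) ^ m *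
        (fps_const (p ^ k) * segment p 0 (t - k + 1)) * (J * (W + Q * T)))"
      unfolding r Q_def by (simp add: power_mult_distrib power_add power_mult mult_ac)
    moreover have "n < g * m + k * m + k"
      using m by (simp add: algebra_simps)
    ultimately show ?thesis
      by (simp only: fps_X_power_mult_nth if_True)
  qed
  have Bn: "(Z ^ r * ?s * J) $ n = B (int k) (int g) p q (int r) (int t) (int n)" if "r \<ge> 1" for r
  proof -
    \<comment> \<open>Each factor \<open>Z\<close> carries one \<open>J\<close>, and the final
      \<open>J\<close> makes r + 1 of them, as in \<open>B_eq\<close>.\<close>
    have "Z ^ r * ?s * J = (Q * ?r) ^ r * ?s * J ^ Suc r"
      unfolding Z_def power_mult_distrib[of _ J] by (simp only: power_Suc mult_ac)
    then show ?thesis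
      using B_eq[OF k kt that, of q g p n] by (simp only: Q_def J_def)
  qed
  have Cn: "(Z ^ (r - 1) * ?r * J * W) $ n = C (int k) (int g) p q (int r) (int t) (int n) +
       q * (\<Sum>w=1..g-1. C (int k) (int g) p q (int r) (int t) (int n - int w))" if r: "r \<ge> 1" for r
  proof -
    define F where "F = (Q * ?r) ^ (r - 1) * ?r * J ^ r"
    have F: "F $ i = C (int k) (int g) p q (int r) (int t) (int i)" for i
      unfolding F_def Q_def J_def by (rule C_eq[OF k kt r])
    have "Z ^ (r - 1) * ?r * J * W = F * W"
    proof -
      obtain i where "r = Suc i" using r by (cases r) auto
      then show ?thesis
        unfolding Z_def F_def power_mult_distrib[of _ J] by (simp only: diff_Suc_1 power_Suc mult_ac)
    qed
    \<comment> \<open>The powers of X in \<open>W\<close> shift the index, which yields the terms at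
      n - w.\<close>
    also have "\<dots> = F + fps_const q * (\<Sum>w=1..g-1. fps_X ^ w * F)"
      by (simp add: W_def algebra_simps sum_distrib_left)
    finally have "(Z ^ (r - 1) * ?r * J * W) $ n =
        F $ n + q * (\<Sum>w=1..g-1. if n < w then 0 else F $ (n - w))"
      by (simp add: fps_sum_nth fps_X_power_mult_nth)
    also have "(\<Sum>w=1..g-1. if n < w then 0 else F $ (n - w)) =
        (\<Sum>w=1..g-1. C (int k) (int g) p q (int r) (int t) (int n - int w))"
      using C_neg[OF g kt r] by (intro sum.cong) (auto simp: F of_nat_diff)
    finally show ?thesis by (simp add: F)
  qed
  have "state_prob k g t p q 0 n = T $ n"
    by (simp add: T_def)
  also have "\<dots> = (?s * J) $ n + (\<Sum>r=1..m. (Z ^ r * ?s * J) $ n + (Z ^ (r - 1) * ?r * J * W) $ n)"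
    by (subst expand[of m]) (simp only: fps_add_nth fps_sum_nth rem add_0_right)
  also have "(?s * J) $ n = P0 (int k) p q (int n)"
    unfolding J_def by (rule sum_star_nth[OF k])
  also have "(\<Sum>r=1..m. (Z ^ r * ?s * J) $ n + (Z ^ (r - 1) * ?r * J * W) $ n) =
    (\<Sum>r=1..m. B (int k) (int g) p q (int r) (int t) (int n) +
       C (int k) (int g) p q (int r) (int t) (int n) +
       q * (\<Sum>w=1..g-1. C (int k) (int g) p q (int r) (int t) (int n - int w)))"
    by (intro sum.cong refl) (simp only: Bn Cn atLeastAtMost_iff add.assoc)
  finally show ?thesis .
qed

section \<open>Transfer to the given random variables\<close>

theorem theorem4p7:
  fixes M :: "'a measure" and X :: "nat \<Rightarrow> 'a \<Rightarrow> bool"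
    and k g n t :: nat and p q :: real
  assumes "k \<ge> 1" and "g \<ge> 1" and "n \<ge> 1"
    and "k \<le> t" and "t \<le> n"
    and "0 < p" and "p < 1" and "q = 1 - p"
    and "prob_space M"
    and "prob_space.indep_vars M (\<lambda>_. count_space UNIV) X {1..n}"
    and "\<And>i. i \<in> {1..n} \<Longrightarrow> measure M {\<omega> \<in> space M. X i \<omega>} = p"
  shows "measure M {\<omega> \<in> space M. \<not> (\<exists>j a b. success_run (\<lambda>i. X i \<omega>) n k g j a b)}
           = P0 (int k) p q (int n) \<and>
         measure M {\<omega> \<in> space M. longest_run (\<lambda>i. X i \<omega>) n k g \<le> t}
           = P0 (int k) p q (int n) +
             (\<Sum>r = 1..(int n + int g) div (int k + int g).
                B (int k) (int g) p q r (int t) (int n) + C (int k) (int g) p q r (int t) (int n) +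
                q * (\<Sum>w = 1..int g - 1. C (int k) (int g) p q r (int t) (int n - w)))"
proof -
  interpret prob_space M by fact
  have pq: "p + q = 1" using assms(8) by simp
  \<comment> \<open>The search starts with c = d = 0; the bound stays general because both k - 1 and
    t are needed.\<close>
  have runs: "(\<forall>a b. run_from x n k g 0 a b \<longrightarrow> b + 1 - a \<le> t') \<longleftrightarrow>
      runs_le k g t' 0 (map x [1..<Suc n])" if "k \<le> Suc t'" for x t'
    using runs_le_iff[of k g t' 0 0 n x] assms(1,2) that by simp
  have prob: "prob {\<omega> \<in> space M. F (map (\<lambda>i. X i \<omega>) [1..<Suc n])} = word_prob p q n F" for F
    using prob_word[OF assms(10,11,3,8)] .
  have "prob {\<omega> \<in> space M. \<not> (\<exists>j a b. success_run (\<lambda>i. X i \<omega>) n k g j a b)} =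
      state_prob k g (k - 1) p q 0 n"
    unfolding ex_success_run_iff_long[OF assms(1)] not_not state_prob_def prob[symmetric]
    by (subst runs) auto
  moreover have "prob {\<omega> \<in> space M. longest_run (\<lambda>i. X i \<omega>) n k g \<le> t} = state_prob k g t p q 0 n"
    unfolding longest_run_le_iff state_prob_def prob[symmetric]
    using assms(4) by (subst runs) auto
  moreover define m where "m = (n + g) div (k + g)"
  moreover have "n + g < Suc m * (k + g)"
    unfolding m_def using assms(1) by (simp add: dividend_less_div_times)
  moreover have "(int n + int g) div (int k + int g) = int m"
    by (simp add: m_def zdiv_int)
  moreover have "int g - 1 = int (g - 1)"
    using assms(2) by simp
  ultimately show ?thesis
    using state_prob_no_runs[OF pq assms(2,1)] state_prob_eq[OF pq assms(2,1,4)]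
    by (simp only: sum_int_from_1)
qed

end
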